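(* Let $\mathcal{P} \subseteq \mathbb{R}_+^I$ be a convex set and let $\mathcal{R}$ be a set of revenue functions $R : \mathcal{P} \to \mathbb{R}$ such that every $R \in \mathcal{R}$ is a concave function of $\mathbf{p}$. Then the robust price optimization problem is randomization-proof, that is, $Z^*_{\mathrm{RR}} = Z^*_{\mathrm{DR}}$.
   Context: $I$ is a positive integer (the number of products), $\mathbb{R}_+$ is the set of nonnegative reals, $\mathcal{P}\subseteq\mathbb{R}_+^I$ is the set of feasible price vectors, and $\mathcal{R}$ is an arbitrary (uncertainty) set of real-valued revenue functions on $\mathcal{P}$. The deterministic robust price optimization problem has optimal value $$Z^*_{\mathrm{DR}} = \max_{\mathbf{p}\in\mathcal{P}} \min_{R\in\mathcal{R}} R(\mathbf{p}).$$ The randomized robust price optimization problem has optimal value $$Z^*_{\mathrm{RR}} = \max_{F\in\mathcal{F}} \min_{R\in\mathcal{R}} \int_{\mathcal{P}} R(\mathbf{p})\,dF(\mathbf{p}),$$ where $\mathcal{F}$ is the set of all probability distributions supported on $\mathcal{P}$. The robust price optimization problem is called randomization-proof if $Z^*_{\mathrm{RR}} = Z^*_{\mathrm{DR}}$.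
   Formalization: The randomized problem ranges only over distributions on P with finite mean price vector (automatic if P is bounded); for all distributions the claim fails, e.g. P=[0,∞), R_k(p)=min(p/k,c_k), F of infinite mean. Max and min are read as supremum and infimum. *)

theory Defs
  imports "HOL-Probability.Probability"
begin

text \<open>
  Throughout, \<open>P\<close> is the set of feasible price vectors and \<open>\<R>\<close> the uncertainty set. Revenue
  functions are total, but only their values on \<open>P\<close> enter below. The optimal values are taken in
  \<open>ereal\<close>, with max and min read as supremum and infimum, so no attainment is presupposed.
\<close>

definition Z_DR :: "(real ^ 'i) set \<Rightarrow> ((real ^ 'i) \<Rightarrow> real) set \<Rightarrow> ereal" where
  "Z_DR P \<R> = (SUP p\<in>P. INF R\<in>\<R>. ereal (R p))"

text \<open>The trace sigma-algebra is used because a convex set need not be Borel.\<close>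

definition prob_distributions :: "(real ^ 'i) set \<Rightarrow> (real ^ 'i) measure set" where
  "prob_distributions P = {F. prob_space F \<and> sets F = sets (restrict_space borel P)}"

text \<open>
  The randomized problem ranges over distributions whose expected price vector exists. Without
  this, the concave functions \<open>R\<^sub>k p = min (p / k) c\<^sub>k\<close> on \<open>[0, \<infinity>)\<close> have pointwise infimum 0, while
  for a distribution of infinite mean the constants \<open>c\<^sub>k\<close> can be chosen such that every \<open>R\<^sub>k\<close> has
  expectation at least 1. For bounded \<open>P\<close> the requirement is vacuous.
\<close>

definition price_distributions :: "(real ^ 'i) set \<Rightarrow> (real ^ 'i) measure set" where
  "price_distributions P = {F \<in> prob_distributions P. integrable F (\<lambda>p. p)}"

lemma price_distributions_bounded:
  assumes "bounded P"
  shows "price_distributions P = prob_distributions P"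
proof -
  have "integrable F (\<lambda>p. p)" if "F \<in> prob_distributions P" for F
  proof -
    interpret prob_space F using that by (simp add: prob_distributions_def)
    have F: "sets F = sets (restrict_space borel P)"
      using that by (simp add: prob_distributions_def)
    have "space F = P"
      using sets_eq_imp_space_eq[OF F] by (simp add: space_restrict_space)
    moreover obtain B where "\<And>p. p \<in> P \<Longrightarrow> norm p \<le> B"
      using assms by (auto simp: bounded_iff)
    moreover have "(\<lambda>p. p) \<in> borel_measurable F"
      unfolding measurable_cong_sets[OF F refl] by (intro measurable_restrict_space1) simp
    ultimately show ?thesis
      by (intro integrable_const_bound[of _ B]) auto
  qed
  then show ?thesis by (auto simp: price_distributions_def)
qed

text \<open>
  The integral with values in the extended reals: unlike the Bochner integral, which is 0 for a
  non-integrable function, it is \<open>-\<infinity>\<close> if only the negative part has infinite integral. (A concave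
  function on \<open>P\<close> has an affine upper bound there, so under a distribution of finite mean its positive
  part always has finite integral.) Concave functions can be non-measurable on the boundary of \<open>P\<close>;
  for those the two nonnegative integrals are lower integrals.
\<close>

definition ext_integral :: "'a measure \<Rightarrow> ('a \<Rightarrow> real) \<Rightarrow> ereal" where
  "ext_integral M f =
     enn2ereal (\<integral>\<^sup>+ x. ennreal (f x) \<partial>M) - enn2ereal (\<integral>\<^sup>+ x. ennreal (- f x) \<partial>M)"

lemma ext_integral_eq_integral:
  assumes "integrable M f"
  shows "ext_integral M f = ereal (\<integral>x. f x \<partial>M)"
proof -
  obtain r q where rq: "0 \<le> r" "0 \<le> q"
    "(\<integral>\<^sup>+ x. ennreal (f x) \<partial>M) = ennreal r" "(\<integral>\<^sup>+ x. ennreal (- f x) \<partial>M) = ennreal q"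
    "(\<integral>x. f x \<partial>M) = r - q"
    using integrableE[OF assms] by metis
  then show ?thesis by (simp add: ext_integral_def enn2ereal_ennreal)
qed

definition Z_RR :: "(real ^ 'i) set \<Rightarrow> ((real ^ 'i) \<Rightarrow> real) set \<Rightarrow> ereal" where
  "Z_RR P \<R> = (SUP F\<in>price_distributions P. INF R\<in>\<R>. ext_integral F R)"

definition randomization_proof :: "(real ^ 'i) set \<Rightarrow> ((real ^ 'i) \<Rightarrow> real) set \<Rightarrow> bool" where
  "randomization_proof P \<R> \<longleftrightarrow> Z_RR P \<R> = Z_DR P \<R>"

end

theory Submission
  imports Defs
begin

text \<open>
  Under a distribution \<open>F\<close> of mean \<open>m\<close>, a supporting hyperplane of \<open>P\<close> at \<open>m\<close> carries all the mass
  of \<open>F\<close>. Cutting \<open>P\<close> down to such hyperplanes lowers the dimension, and therefore ends in a convex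
  \<open>Q \<subseteq> P\<close> of full measure with \<open>m\<close> in its relative interior. There a concave function has an affine
  majorant that is exact at \<open>m\<close>, which gives Jensen's inequality without any measurability or
  openness assumption. So the deterministic price \<open>m\<close> does at least as well as \<open>F\<close>; conversely
  deterministic prices are point masses.
\<close>

text \<open>The epigraph has a supporting hyperplane at \<open>(m, f m)\<close>. Since
  \<open>m\<close> is in the relative interior of \<open>S\<close>, this hyperplane is not vertical,
  so it is the graph of an affine minorant.\<close>

lemma convex_on_rel_interior_subgradient:
  fixes f :: "'a::euclidean_space \<Rightarrow> real"
  assumes f: "convex_on S f" and m: "m \<in> rel_interior S"
  obtains c where "\<And>x. x \<in> S \<Longrightarrow> f m + c \<bullet> (x - m) \<le> f x"
proof -
  let ?E = "epigraph S f"
  have S: "convex S" using f by (simp add: convex_on_def)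
  have mS: "m \<in> S" using m rel_interior_subset by blast
  have E: "convex ?E" using f S by (simp add: convex_epigraph)
  have mE: "(m, f m) \<in> ?E" using mS by (simp add: epigraph_def)
  \<comment> \<open>Otherwise the vertical segment down from \<open>(m, f m + 1)\<close> could be
    prolonged past \<open>(m, f m)\<close> inside the epigraph.\<close>
  have "(m, f m) \<notin> rel_interior ?E"
  proof
    assume "(m, f m) \<in> rel_interior ?E"
    moreover have "(m, f m + 1) \<in> ?E" using mS by (simp add: epigraph_def)
    ultimately obtain e where e: "e > 1" "(1 - e) *\<^sub>R (m, f m + 1) + e *\<^sub>R (m, f m) \<in> ?E"
      using convex_rel_interior_iff[OF E] mE by blast
    have "(1 - e) *\<^sub>R m + e *\<^sub>R m = m" by (simp add: algebra_simps)
    with e show False by (simp add: epigraph_def algebra_simps)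
  qed
  then obtain a where a: "\<And>z. z \<in> ?E \<Longrightarrow> a \<bullet> (m, f m) \<le> a \<bullet> z"
      "\<And>z. z \<in> rel_interior ?E \<Longrightarrow> a \<bullet> (m, f m) < a \<bullet> z"
    using supporting_hyperplane_rel_boundary[OF E mE] by metis
  obtain c t where ct: "a = (c, t)" by (cases a)
  have le: "c \<bullet> m + t * f m \<le> c \<bullet> x + t * r" if "x \<in> S" "f x \<le> r" for x r
    using a(1)[of "(x, r)"] that by (simp add: ct epigraph_def)
  have "t \<ge> 0" using le[OF mS, of "f m + 1"] by (simp add: algebra_simps)
  \<comment> \<open>If \<open>t = 0\<close>, then \<open>c\<close> is minimal over \<open>S\<close>
    at \<open>m\<close> but strictly larger at some \<open>x\<close> in \<open>S\<close>. Prolonging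
    the segment from \<open>x\<close> slightly past \<open>m\<close> stays in \<open>S\<close> and
    goes below the minimum.\<close>
  moreover have "t \<noteq> 0"
  proof
    assume t: "t = 0"
    obtain z where z: "z \<in> rel_interior ?E"
      using rel_interior_eq_empty[OF E] mE by blast
    obtain x r where xr: "z = (x, r)" by (cases z)
    have lt: "c \<bullet> m < c \<bullet> x" using a(2)[OF z] by (simp add: ct t xr)
    have "x \<in> S" using z rel_interior_subset[of ?E] by (auto simp: xr epigraph_def)
    then obtain e where e: "e > 1" "(1 - e) *\<^sub>R x + e *\<^sub>R m \<in> S"
      using convex_rel_interior_iff[OF S] m mS by blast
    have "c \<bullet> m \<le> (1 - e) * (c \<bullet> x) + e * (c \<bullet> m)"
      using le[OF e(2) order_refl] by (simp add: t inner_add_right)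
    then have "(e - 1) * (c \<bullet> x) \<le> (e - 1) * (c \<bullet> m)" by (simp add: algebra_simps)
    then show False using e(1) lt by simp
  qed
  ultimately have t: "t > 0" by simp
  show thesis
  \<comment> \<open>The slope comes from solving the hyperplane with normal \<open>(c, t)\<close>
    for its last coordinate.\<close>
  proof (rule that[of "(- 1 / t) *\<^sub>R c"])
    fix x assume "x \<in> S"
    from le[OF this order_refl] have "t * (f m + (- 1 / t) * (c \<bullet> (x - m))) \<le> t * f x"
      using t by (simp add: algebra_simps)
    then show "f m + ((- 1 / t) *\<^sub>R c) \<bullet> (x - m) \<le> f x" using t by simp
  qed
qed

lemma (in prob_space) AE_rel_interior_expectation:
  fixes X :: "'a \<Rightarrow> 'b::euclidean_space"
  assumes X: "integrable M X" and "convex Q" and "AE x in M. X x \<in> Q"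
  obtains Q' where "Q' \<subseteq> Q" "convex Q'" "AE x in M. X x \<in> Q'"
    "expectation X \<in> rel_interior Q'"
proof -
  define m where "m = expectation X"
  have int: "integrable M (\<lambda>x. a \<bullet> X x)" and exp: "expectation (\<lambda>x. a \<bullet> X x) = a \<bullet> m" for a
    using X by (simp_all add: m_def)
  have "\<exists>Q'\<subseteq>Q. convex Q' \<and> (AE x in M. X x \<in> Q') \<and> m \<in> rel_interior Q'"
    using assms(2,3)
  \<comment> \<open>As \<open>aff_dim\<close> is at least -1, the shift by 1 lets \<open>nat\<close>
    preserve strict decrease.\<close>
  proof (induction "nat (aff_dim Q + 1)" arbitrary: Q rule: less_induct)
    case less
    have Q: "convex Q" and AE: "AE x in M. X x \<in> Q" using less.prems by auto
    have ne: "Q \<noteq> {}" using AE by (auto simp: AE_False)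
    have cl: "m \<in> closure Q"
    proof (rule ccontr)
      assume "m \<notin> closure Q"
      then obtain a b where ab: "a \<bullet> m < b" "\<And>x. x \<in> closure Q \<Longrightarrow> a \<bullet> x > b"
        using separating_hyperplane_closed_point[of "closure Q" m] Q by auto
      have "b \<le> expectation (\<lambda>x. a \<bullet> X x)"
        using AE ab(2) closure_subset[of Q] by (intro integral_ge_const int) fastforce
      with ab(1) show False by (simp add: exp)
    qed
    show ?case
    proof (cases "m \<in> rel_interior Q")
      case True
      with Q AE show ?thesis by blast
    next
      case False
      obtain a where a: "\<And>y. y \<in> closure Q \<Longrightarrow> a \<bullet> m \<le> a \<bullet> y"
        "\<And>y. y \<in> rel_interior Q \<Longrightarrow> a \<bullet> m < a \<bullet> y"
        using supporting_hyperplane_relative_frontier[OF Q cl False] by metis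
      let ?H = "{y. a \<bullet> y = a \<bullet> m}"
      \<comment> \<open>A nonnegative variable of mean 0 vanishes almost surely, so \<open>X\<close>
        stays on the hyperplane \<open>?H\<close>.\<close>
      have "AE x in M. 0 \<le> a \<bullet> X x - a \<bullet> m"
        using AE a(1) closure_subset[of Q] by fastforce
      moreover have "integrable M (\<lambda>x. a \<bullet> X x - a \<bullet> m)"
        "expectation (\<lambda>x. a \<bullet> X x - a \<bullet> m) = 0"
        using int[of a] exp[of a] by (simp_all add: prob_space)
      ultimately have "AE x in M. a \<bullet> X x - a \<bullet> m = 0"
        using integral_nonneg_eq_0_iff_AE by blast
      with AE have AE': "AE x in M. X x \<in> Q \<inter> ?H" by eventually_elim auto
      \<comment> \<open>A relative interior point lies strictly off \<open>?H\<close>, so the cut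
        lowers the affine dimension.\<close>
      obtain y where y: "y \<in> rel_interior Q" using rel_interior_eq_empty[OF Q] ne by blast
      have "affine hull (Q \<inter> ?H) \<subseteq> ?H"
        by (intro hull_minimal) (auto simp: affine_hyperplane)
      then have "y \<notin> affine hull (Q \<inter> ?H)" using a(2)[OF y] by auto
      moreover have "y \<in> affine hull Q"
        using y rel_interior_subset hull_subset[of Q affine] by blast
      ultimately have "affine hull (Q \<inter> ?H) \<subset> affine hull Q"
        using hull_mono[of "Q \<inter> ?H" Q affine] by blast
      then have "aff_dim (Q \<inter> ?H) < aff_dim Q" by (rule aff_dim_psubset)
      then have "nat (aff_dim (Q \<inter> ?H) + 1) < nat (aff_dim Q + 1)"
        using aff_dim_geq[of "Q \<inter> ?H"] by linarith
      moreover have "convex (Q \<inter> ?H)" by (intro convex_Int Q convex_hyperplane)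
      ultimately show ?thesis using less.hyps[OF _ _ AE'] by blast
    qed
  qed
  then show thesis using that by (auto simp: m_def)
qed

text \<open>Holds for arbitrary functions: \<open>nn_integral\<close> is monotone without
  measurability, and subtraction in \<open>ereal\<close> is monotone even with the convention
  \<open>\<infinity> - \<infinity> = \<infinity>\<close>.\<close>

lemma ext_integral_mono_AE:
  assumes "AE x in M. f x \<le> g x"
  shows "ext_integral M f \<le> ext_integral M g"
proof -
  have "(\<integral>\<^sup>+ x. ennreal (f x) \<partial>M) \<le> (\<integral>\<^sup>+ x. ennreal (g x) \<partial>M)"
    using assms by (intro nn_integral_mono_AE) (auto intro: ennreal_leI)
  moreover have "(\<integral>\<^sup>+ x. ennreal (- g x) \<partial>M) \<le> (\<integral>\<^sup>+ x. ennreal (- f x) \<partial>M)"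
    by (rule nn_integral_mono_AE, use assms in eventually_elim) (simp add: ennreal_leI)
  ultimately show ?thesis
    unfolding ext_integral_def by (intro ereal_minus_mono) (simp_all add: less_eq_ennreal.rep_eq)
qed

lemma (in prob_space) concave_expectation_bound:
  fixes X :: "'a \<Rightarrow> 'b::euclidean_space"
  assumes X: "integrable M X" "AE x in M. X x \<in> P" and f: "concave_on P f"
  shows "expectation X \<in> P" and "ext_integral M (\<lambda>x. f (X x)) \<le> ereal (f (expectation X))"
proof -
  let ?m = "expectation X"
  have "convex P" using f by (simp add: concave_on_def convex_on_def)
  \<comment> \<open>On \<open>P\<close> itself an affine majorant exact at the mean may fail to
    exist, as for the square root on the nonnegative reals and the point mass at 0.\<close>
  then obtain Q where Q: "Q \<subseteq> P" "convex Q" "AE x in M. X x \<in> Q" "?m \<in> rel_interior Q"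
    using AE_rel_interior_expectation X by metis
  then show "?m \<in> P" using rel_interior_subset by blast
  have "convex_on Q (\<lambda>x. - f x)"
    using f Q(1,2) by (auto simp: concave_on_def intro: convex_on_subset)
  then obtain c where c: "\<And>x. x \<in> Q \<Longrightarrow> - f ?m + c \<bullet> (x - ?m) \<le> - f x"
    using convex_on_rel_interior_subgradient Q(4) by metis
  let ?g = "\<lambda>x. f ?m - (c \<bullet> X x - c \<bullet> ?m)"
  have "AE x in M. f (X x) \<le> ?g x"
    using Q(3) by eventually_elim (use c in \<open>fastforce simp: inner_diff_right\<close>)
  then have "ext_integral M (\<lambda>x. f (X x)) \<le> ext_integral M ?g"
    by (rule ext_integral_mono_AE)
  also have "\<dots> = ereal (expectation ?g)"
    using X(1) by (intro ext_integral_eq_integral) simp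
  also have "expectation ?g = f ?m"
    using X(1) by (simp add: prob_space)
  finally show "ext_integral M (\<lambda>x. f (X x)) \<le> ereal (f ?m)" .
qed

text \<open>Points are closed in a T1 space, so \<open>P - {p}\<close> is the trace of an open set
  and serves as the null set.\<close>

lemma AE_point_mass:
  fixes p :: "'a::t1_space"
  assumes "p \<in> P"
  shows "AE x in return (restrict_space borel P) p. x = p"
proof -
  have "P - {p} \<in> sets (restrict_space borel P)"
    by (auto simp: sets_restrict_space intro!: image_eqI[of _ _ "- {p}"])
  then show ?thesis
    using assms by (intro AE_I[of _ _ "P - {p}"]) (auto simp: space_restrict_space)
qed

lemma ext_integral_cong_AE:
  assumes "AE x in M. f x = g x"
  shows "ext_integral M f = ext_integral M g"
  using assms by (intro antisym ext_integral_mono_AE) auto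

lemma point_mass_price_distribution:
  assumes "p \<in> P"
  shows "return (restrict_space borel P) p \<in> price_distributions P"
    and "ext_integral (return (restrict_space borel P) p) R = ereal (R p)"
proof -
  let ?D = "return (restrict_space borel P) p"
  interpret prob_space ?D
    using assms by (intro prob_space_return) (simp add: space_restrict_space)
  have AE: "AE x in ?D. x = p" using assms by (rule AE_point_mass)
  have "(\<lambda>x. x) \<in> borel_measurable ?D"
    by (simp add: measurable_restrict_space1)
  then have "integrable ?D (\<lambda>x. x)"
    using AE by (intro integrable_const_bound[of _ "norm p"]) auto
  then show "?D \<in> price_distributions P"
    by (simp add: price_distributions_def prob_distributions_def prob_space_axioms)
  \<comment> \<open>\<open>R\<close> may be non-measurable, so it is replaced by the constant that
    it equals almost surely.\<close>
  have "ext_integral ?D R = ext_integral ?D (\<lambda>_. R p)"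
    using AE by (intro ext_integral_cong_AE) auto
  also have "\<dots> = ereal (R p)" using prob_space by (simp add: ext_integral_eq_integral)
  finally show "ext_integral ?D R = ereal (R p)" .
qed

theorem theorem1:
  fixes P :: "(real ^ 'i::finite) set" and \<R> :: "((real ^ 'i) \<Rightarrow> real) set"
  assumes "P \<subseteq> {p. \<forall>i. 0 \<le> p $ i}"
    and "convex P"
    and "\<And>R. R \<in> \<R> \<Longrightarrow> concave_on P R"
  shows "randomization_proof P \<R>"
  unfolding randomization_proof_def
proof (rule antisym)
  show "Z_RR P \<R> \<le> Z_DR P \<R>"
    unfolding Z_RR_def Z_DR_def
  proof (rule SUP_mono)
    fix F assume F: "F \<in> price_distributions P"
    then interpret prob_space F by (simp add: price_distributions_def prob_distributions_def)
    have sets: "sets F = sets (restrict_space borel P)" and int: "integrable F (\<lambda>p. p)"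
      using F by (simp_all add: price_distributions_def prob_distributions_def)
    have AE: "AE p in F. p \<in> P"
      using sets_eq_imp_space_eq[OF sets] by (intro AE_I2) (simp add: space_restrict_space)
    \<comment> \<open>\<open>\<R>\<close> may be empty, so the zero function serves to place the
      mean in \<open>P\<close>.\<close>
    have "concave_on P (\<lambda>_. 0)" using assms(2) by (simp add: concave_on_def convex_on_def)
    then have "expectation (\<lambda>p. p) \<in> P" by (rule concave_expectation_bound(1)[OF int AE])
    moreover have "(INF R\<in>\<R>. ext_integral F R) \<le> (INF R\<in>\<R>. ereal (R (expectation (\<lambda>p. p))))"
      using concave_expectation_bound(2)[OF int AE] assms(3) by (intro INF_mono) auto
    ultimately show "\<exists>p\<in>P. (INF R\<in>\<R>. ext_integral F R) \<le> (INF R\<in>\<R>. ereal (R p))" by blast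
  qed
  show "Z_DR P \<R> \<le> Z_RR P \<R>"
    unfolding Z_RR_def Z_DR_def
  proof (rule SUP_mono)
    fix p assume "p \<in> P"
    note D = point_mass_price_distribution[OF this]
    show "\<exists>F\<in>price_distributions P. (INF R\<in>\<R>. ereal (R p)) \<le> (INF R\<in>\<R>. ext_integral F R)"
      by (rule bexI[OF _ D(1)]) (simp add: D(2))
  qed
qed

end
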